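(* Let $f=\frac1n\sum_{i=1}^n f_i$ with differentiable $f_i:\mathbb{R}^d\to\mathbb{R}$, and let $\mu,L>0$ be such that for all $v,w\in\mathbb{R}^d$ and $i=1,\dots,n$, $$f(w)\ge f(v)+\nabla f(v)^{\mathsf T}(w-v)+\frac{\mu}{2}\|v-w\|^2,\qquad \|\nabla f_i(v)-\nabla f_i(w)\|\le L\|v-w\|.$$ Let $x^*=\operatorname{argmin}_x f(x)$ and $\kappa=L/\mu$. If $m$ and $b$ are chosen so that $$\rho=\frac{\kappa m+4\kappa b(1+1/m)}{mb-4\kappa b}<1,\qquad m>\max(4\kappa,b\kappa),$$ then the iterates $x_k$ of the Stochastic Steffensen--Barzilai--Borwein Method (SSBB) with inner loop size $m$ and minibatch size $b$ converge linearly in expectation: $$\mathbb{E}[f(x_k)-f(x^* )]\le\rho^k[f(x_0)-f(x^* )],\qquad k=0,1,2,\dots.$$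
   Context: Stochastic Steffensen--Barzilai--Borwein Method (SSBB). Input: $x_0\in\mathbb{R}^d$, positive integers $m$ and $b\le n$, and $\beta_0=-1$. For $S\subseteq\{1,\dots,n\}$ with $|S|=b$, write $\nabla f_S=\frac1b\sum_{j\in S}\nabla f_j$. For $k=0,1,2,\dots$: compute $\nabla f(x_k)$; if $k>0$, set $s_k=x_k-x_{k-1}$, $y_k=\nabla f(x_k)-\nabla f(x_{k-1})$ and $\beta_k=-\|s_k\|^2/(s_k^{\mathsf T}y_k)$; set $$\eta_k=\frac bm\cdot\frac{\beta_k\|\nabla f(x_k)\|^2}{[\nabla f(x_k+\beta_k\nabla f(x_k))-\nabla f(x_k)]^{\mathsf T}\nabla f(x_k)};$$ set $x_{k,0}=x_k$; for $t=0,\dots,m-1$, sample $S_{k,t}$ uniformly from the $b$-element subsets of $\{1,\dots,n\}$ (independently of everything before), set $v_{k,t}=\nabla f_{S_{k,t}}(x_{k,t})-\nabla f_{S_{k,t}}(x_k)+\nabla f(x_k)$ and $x_{k,t+1}=x_{k,t}-\eta_k v_{k,t}$; finally set $x_{k+1}=x_{k,i}$ for $i$ chosen uniformly from $\{0,\dots,m-1\}$. Conventions for degenerate cases: if $x_k=x_{k-1}$, take $\beta_k=-1$; if $\nabla f(x_k)=0$, then $x_k=x^*$, $\eta_k$ may be taken to be any positive number (e.g. $b/(mL)$), and all subsequent iterates equal $x^*$. *)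

theory Defs
  imports "HOL-Probability.Probability"
begin

definition grad :: "('a::real_inner \<Rightarrow> real) \<Rightarrow> 'a \<Rightarrow> 'a" where
  "grad f x = (THE D. GDERIV f x :> D)"

lemma grad_eqI: "GDERIV f x :> D \<Longrightarrow> grad f x = D"
  unfolding grad_def
proof (rule the_equality, assumption)
  fix D' assume "GDERIV f x :> D" "GDERIV f x :> D'"
  then have "(\<lambda>h. inner h D) = (\<lambda>h. inner h D')"
    unfolding gderiv_def by (rule has_derivative_unique)
  then have "inner h D = inner h D'" for h by meson
  then show "D' = D" by (metis vector_eq_rdot vector_eq_ldot)
qed

lemma GDERIV_grad:
  fixes f :: "'a::euclidean_space \<Rightarrow> real"
  assumes "f differentiable at x"
  shows "GDERIV f x :> grad f x"
proof -
  from assms obtain f' where f': "(f has_derivative f') (at x)"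
    unfolding differentiable_def by blast
  then have lin: "linear f'" by (rule has_derivative_linear)
  define D where "D = adjoint f' 1"
  have "f' = (\<lambda>h. inner h D)"
    using adjoint_works[OF lin, of _ 1] unfolding D_def by auto
  with f' have "GDERIV f x :> D" by (simp add: gderiv_def)
  then show ?thesis using grad_eqI by metis
qed

definition objective :: "nat \<Rightarrow> (nat \<Rightarrow> 'a \<Rightarrow> real) \<Rightarrow> 'a \<Rightarrow> real" where
  "objective n f x = (1 / real n) * (\<Sum>i=1..n. f i x)"

definition minibatch_grad ::
    "nat \<Rightarrow> (nat \<Rightarrow> 'a::real_inner \<Rightarrow> real) \<Rightarrow> nat set \<Rightarrow> 'a \<Rightarrow> 'a" where
  "minibatch_grad b f S x = (1 / real b) *\<^sub>R (\<Sum>j\<in>S. grad (f j) x)"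

text \<open>Here and below, \<open>F\<close> is the objective, \<open>xp\<close> is the previous outer iterate
  \<open>x_{k-1}\<close> and \<open>x\<close> is the current one \<open>x_k\<close>.\<close>

definition bb_beta :: "('a::real_inner \<Rightarrow> real) \<Rightarrow> nat \<Rightarrow> 'a \<Rightarrow> 'a \<Rightarrow> real" where
  "bb_beta F k xp x =
    (if k = 0 \<or> x = xp then -1
     else let s = x - xp; y = grad F x - grad F xp
          in - ((norm s)\<^sup>2 / inner s y))"

text \<open>The parameter \<open>e\<close> is the step size used when the gradient vanishes at \<open>x\<close>.\<close>

definition steffensen_eta ::
    "('a::real_inner \<Rightarrow> real) \<Rightarrow> nat \<Rightarrow> nat \<Rightarrow> real \<Rightarrow> real \<Rightarrow> 'a \<Rightarrow> real" where
  "steffensen_eta F m b e \<beta> x =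
    (if grad F x = 0 then e
     else real b / real m *
       (\<beta> * (norm (grad F x))\<^sup>2 / inner (grad F (x + \<beta> *\<^sub>R grad F x) - grad F x) (grad F x)))"

text \<open>\<open>inner_path n b f \<eta> x t\<close> is the joint distribution of the list
  \<open>[x_{k,0}, \<dots>, x_{k,t}]\<close> of inner iterates, given \<open>x_k = x\<close> and \<open>\<eta>_k = \<eta>\<close>. Each step binds a
  new \<open>pmf_of_set\<close>, so its minibatch is independent of everything sampled before.\<close>

primrec inner_path ::
    "nat \<Rightarrow> nat \<Rightarrow> (nat \<Rightarrow> 'a::real_inner \<Rightarrow> real) \<Rightarrow> real \<Rightarrow> 'a \<Rightarrow> nat \<Rightarrow> 'a list pmf" where
  "inner_path n b f \<eta> x 0 = return_pmf [x]"
| "inner_path n b f \<eta> x (Suc t) =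
    bind_pmf (inner_path n b f \<eta> x t) (\<lambda>xs.
    bind_pmf (pmf_of_set {S. S \<subseteq> {1..n} \<and> card S = b}) (\<lambda>S.
      let z = last xs;
          v = minibatch_grad b f S z - minibatch_grad b f S x + grad (objective n f) x
      in return_pmf (xs @ [z - \<eta> *\<^sub>R v])))"

definition outer_step ::
    "nat \<Rightarrow> nat \<Rightarrow> nat \<Rightarrow> (nat \<Rightarrow> 'a::real_inner \<Rightarrow> real) \<Rightarrow> real \<Rightarrow> 'a \<Rightarrow> 'a pmf" where
  "outer_step n m b f \<eta> x =
    bind_pmf (inner_path n b f \<eta> x m) (\<lambda>xs.
    bind_pmf (pmf_of_set {0..<m}) (\<lambda>i. return_pmf (xs ! i)))"

text \<open>Joint distribution of \<open>(x_{k-1}, x_k)\<close>. For \<open>k = 0\<close> there is no previous iterate; the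
  first component is then a dummy, ignored by \<open>bb_beta\<close>. The number \<open>e k\<close> is
  the arbitrary choice of \<open>\<eta>_k\<close> when the gradient at \<open>x_k\<close> is zero.\<close>

primrec ssbb_pair ::
    "nat \<Rightarrow> nat \<Rightarrow> nat \<Rightarrow> (nat \<Rightarrow> 'a::real_inner \<Rightarrow> real) \<Rightarrow> (nat \<Rightarrow> real) \<Rightarrow> 'a \<Rightarrow> nat \<Rightarrow>
     ('a \<times> 'a) pmf" where
  "ssbb_pair n m b f e x0 0 = return_pmf (x0, x0)"
| "ssbb_pair n m b f e x0 (Suc k) =
    bind_pmf (ssbb_pair n m b f e x0 k) (\<lambda>(xp, x).
      let F = objective n f;
          \<beta> = bb_beta F k xp x;
          \<eta> = steffensen_eta F m b (e k) \<beta> x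
      in map_pmf (\<lambda>x'. (x, x')) (outer_step n m b f \<eta> x))"

definition ssbb ::
    "nat \<Rightarrow> nat \<Rightarrow> nat \<Rightarrow> (nat \<Rightarrow> 'a::real_inner \<Rightarrow> real) \<Rightarrow> (nat \<Rightarrow> real) \<Rightarrow> 'a \<Rightarrow> nat \<Rightarrow> 'a pmf" where
  "ssbb n m b f e x0 k = map_pmf snd (ssbb_pair n m b f e x0 k)"

end

theory Submission
  imports Defs
begin

text \<open>
  The component functions need not be convex, so the variance of the stochastic gradient can only
  be compared with \<open>(norm (z - x))\<^sup>2\<close>, where \<open>z\<close> is an inner iterate and \<open>x\<close> the outer iterate
  at which the full gradient was taken. Splitting this as
  \<open>2 * (norm (z - xstar))\<^sup>2 + 2 * (norm (x - xstar))\<^sup>2\<close> doubles the noise, and the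
  resulting rate exceeds \<open>\<rho>\<close> for some step sizes near the upper end of their range. The proof
  avoids the splitting.

  Write \<open>g\<close> for the gradient of \<open>F\<close> and \<open>\<delta> z = F z - F xstar\<close>. The interpolation inequality
  for \<open>\<mu>\<close>-strongly convex \<open>L\<close>-smooth functions at the pair \<open>(x, z)\<close> (lemma \<open>interpolation\<close>)
  gives an upper bound for \<open>\<mu> * (norm (z - x))\<^sup>2\<close> by
  \<open>2 * (\<delta> x - \<delta> z) + 2 * inner (g z) (z - xstar) - 2 * inner (g z) (a x)\<close> plus a term
  of relative order \<open>\<mu> / L\<close>, where
  \<open>a x = (x - xstar) - (g x - \<mu> *\<^sub>R (x - xstar)) /\<^sub>R L\<close>.
  The term \<open>inner (g z) (a x)\<close> has no sign. However, the mean displacement of the inner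
  iteration is \<open>- \<eta> *\<^sub>R g z\<close>, so this term is the expected change of a linear function of \<open>z\<close>
  and can be absorbed in the potential: instead of the distance to \<open>xstar\<close>, the squared
  distance to the shifted point \<open>xstar + Q *\<^sub>R a x\<close> is used, with
  \<open>Q = \<eta> * L\<^sup>2 / (b * \<mu>)\<close>. This potential decreases in expectation by
  \<open>2 * \<eta> * (1 - 2 * Q * \<mu> / L) * \<delta> z\<close> and increases by \<open>2 * \<eta> * Q * \<delta> x\<close>
  (lemma \<open>shifted_distance_drift\<close>), and at \<open>z = x\<close> it is at most \<open>2 / \<mu> * \<delta> x\<close>
  (lemma \<open>shifted_distance_start\<close>). Summing over the inner loop gives
  \<open>(1 - 2 * Q * \<mu> / L) * E \<le> (1 / (\<mu> * \<eta> * m) + Q) * \<delta> x\<close> for the expected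
  suboptimality \<open>E\<close> of the next outer iterate (lemma \<open>outer_step_bound\<close>).

  The Steffensen quotient is a reciprocal Rayleigh-type quotient of a gradient difference, so
  strong convexity and smoothness confine \<open>\<eta>\<close> to
  \<open>[b / (m * L), b / (m * \<mu>)]\<close>, whatever nonzero \<open>\<beta>\<close> is. On this range the right-hand factor is
  at most \<open>\<kappa> / b + \<kappa> / m\<close>, its value at the left end, while \<open>Q * \<mu> / L \<le> \<kappa> / m\<close>.
  The resulting contraction factor is below \<open>\<rho>\<close>.
\<close>

section \<open>Sampling a minibatch without replacement\<close>

lemma card_supersets:
  assumes "finite A" "T \<subseteq> A" "card T \<le> b"
  shows "card {S. S \<subseteq> A \<and> card S = b \<and> T \<subseteq> S} = (card A - card T) choose (b - card T)"
proof -
  have finT: "finite T" using assms finite_subset by blast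
  have "bij_betw (\<lambda>U. U \<union> T) {U. U \<subseteq> A - T \<and> card U = b - card T}
          {S. S \<subseteq> A \<and> card S = b \<and> T \<subseteq> S}"
  proof (rule bij_betw_byWitness[where f' = "\<lambda>S. S - T"])
    show "(\<lambda>U. U \<union> T) ` {U. U \<subseteq> A - T \<and> card U = b - card T}
        \<subseteq> {S. S \<subseteq> A \<and> card S = b \<and> T \<subseteq> S}"
    proof clarify
      fix U assume U: "U \<subseteq> A - T" "card U = b - card T"
      then have "card (U \<union> T) = card U + card T"
        using assms finT by (intro card_Un_disjoint) (auto intro: finite_subset)
      then show "U \<union> T \<subseteq> A \<and> card (U \<union> T) = b \<and> T \<subseteq> U \<union> T" using U assms by auto
    qed
    show "(\<lambda>S. S - T) ` {S. S \<subseteq> A \<and> card S = b \<and> T \<subseteq> S}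
        \<subseteq> {U. U \<subseteq> A - T \<and> card U = b - card T}"
      using finT by (auto simp: card_Diff_subset)
  qed auto
  then have "card {S. S \<subseteq> A \<and> card S = b \<and> T \<subseteq> S}
      = card {U. U \<subseteq> A - T \<and> card U = b - card T}"
    by (simp add: bij_betw_same_card)
  then show ?thesis using assms finT by (simp add: n_subsets card_Diff_subset)
qed

lemma card_supersets_eq:
  assumes "finite A" "T \<subseteq> A" "T' \<subseteq> A" "card T = card T'"
  shows "card {S. S \<subseteq> A \<and> card S = b \<and> T \<subseteq> S} = card {S. S \<subseteq> A \<and> card S = b \<and> T' \<subseteq> S}"
proof (cases "card T \<le> b")
  case True
  then show ?thesis using assms by (simp add: card_supersets)
next
  case False
  have "\<not> (S \<subseteq> A \<and> card S = b \<and> U \<subseteq> S)" if "card U = card T" for U S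
  proof
    assume S: "S \<subseteq> A \<and> card S = b \<and> U \<subseteq> S"
    then have "card U \<le> card S" using assms(1) by (intro card_mono) (auto intro: finite_subset)
    with S False that show False by simp
  qed
  then have empty: "{S. S \<subseteq> A \<and> card S = b \<and> U \<subseteq> S} = {}" if "card U = card T" for U
    using that by blast
  show ?thesis unfolding empty[OF refl] empty[OF assms(4)[symmetric]] ..
qed

text \<open>Both sides count the pairs of a \<open>b\<close>-subset and one of its elements, per element of \<open>A\<close>.\<close>

lemma fraction_of_subsets_containing:
  assumes "finite A" "i \<in> A" "0 < b" "b \<le> card A"
  shows "real (card {S. S \<subseteq> A \<and> card S = b \<and> i \<in> S})
    = real b / real (card A) * real (card {S. S \<subseteq> A \<and> card S = b})"
proof -
  have pos: "card A > 0" using assms by linarith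
  have "card {S. S \<subseteq> A \<and> card S = b \<and> i \<in> S} = (card A - 1) choose (b - 1)"
    using card_supersets[of A "{i}" b] assms by simp
  moreover have "b * (card A choose b) = card A * ((card A - 1) choose (b - 1))"
    using assms(3) by (rule times_binomial_minus1_eq)
  then have "real b * real (card A choose b) = real (card A) * real ((card A - 1) choose (b - 1))"
    by (metis of_nat_mult)
  ultimately show ?thesis using pos assms(1,2) by (auto simp add: n_subsets field_simps)
qed

lemma expectation_subset_sum:
  fixes c :: "'i \<Rightarrow> real"
  assumes "finite A" "0 < b" "b \<le> card A"
  shows "measure_pmf.expectation (pmf_of_set {S. S \<subseteq> A \<and> card S = b}) (\<lambda>S. \<Sum>j\<in>S. c j)
    = real b / real (card A) * (\<Sum>j\<in>A. c j)"
proof -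
  let ?S = "{S. S \<subseteq> A \<and> card S = b}"
  have fin: "finite ?S" using assms(1) by simp
  have ne: "?S \<noteq> {}" using assms(3) by (auto elim: obtain_subset_with_card_n)
  have "(\<Sum>S\<in>?S. \<Sum>j\<in>S. c j) = (\<Sum>S\<in>?S. \<Sum>j | j \<in> A \<and> j \<in> S. c j)"
    by (intro sum.cong refl) auto
  also have "\<dots> = (\<Sum>j\<in>A. \<Sum>S | S \<in> ?S \<and> j \<in> S. c j)"
    using fin assms(1) by (rule sum.swap_restrict)
  also have "\<dots> = (\<Sum>j\<in>A. real b / real (card A) * real (card ?S) * c j)"
    using fraction_of_subsets_containing[OF assms(1) _ assms(2,3)]
    by (intro sum.cong refl) (simp add: conj_assoc)
  finally show ?thesis
    using fin ne card_gt_0_iff[of ?S]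
    by (simp add: integral_pmf_of_set[OF ne fin] flip: sum_distrib_left sum_divide_distrib del: Collect_empty_eq)
qed

text \<open>Sampling without replacement is at least as good as independent sampling. Expand the square
  into inner products of pairs. Off-diagonal pairs all occur in the same number \<open>M\<close> of subsets, and
  since the vectors sum to zero, the off-diagonal inner products add up to minus the diagonal.
  Since \<open>M\<close> is nonnegative, they can only lower the total.\<close>

lemma expectation_norm_centred_subset_sum:
  fixes c :: "'i \<Rightarrow> 'a::real_inner"
  assumes "finite A" "0 < b" "b \<le> card A" and centred: "(\<Sum>j\<in>A. c j) = 0"
  shows "measure_pmf.expectation (pmf_of_set {S. S \<subseteq> A \<and> card S = b}) (\<lambda>S. (norm (\<Sum>j\<in>S. c j))\<^sup>2)
    \<le> real b / real (card A) * (\<Sum>j\<in>A. (norm (c j))\<^sup>2)"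
proof -
  let ?S = "{S. S \<subseteq> A \<and> card S = b}"
  let ?N = "\<lambda>T. real (card {S. S \<subseteq> A \<and> card S = b \<and> T \<subseteq> S})"
  have fin: "finite ?S" using assms(1) by simp
  have ne: "?S \<noteq> {}" using assms(3) by (auto elim: obtain_subset_with_card_n)
  \<comment> \<open>by symmetry every pair of distinct indices lies in the same number of minibatches\<close>
  obtain M where M: "0 \<le> M" "\<And>i j. i \<in> A \<Longrightarrow> j \<in> A \<Longrightarrow> i \<noteq> j \<Longrightarrow> ?N {i, j} = M"
  proof (cases "\<exists>i\<in>A. \<exists>j\<in>A. i \<noteq> j")
    case True
    then obtain i j where ij: "i \<in> A" "j \<in> A" "i \<noteq> j" by blast
    have "?N {i', j'} = ?N {i, j}" if "i' \<in> A" "j' \<in> A" "i' \<noteq> j'" for i' j'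
      using card_supersets_eq[of A "{i', j'}" "{i, j}" b] that ij assms(1) by simp
    then show ?thesis by (intro that[of "?N {i, j}"]) auto
  next
    case False
    then show ?thesis by (intro that[of 0]) auto
  qed
  let ?p = "real b / real (card A) * real (card ?S)"
  have single: "?N {i} = ?p" if "i \<in> A" for i
    using fraction_of_subsets_containing[OF assms(1) that assms(2,3)] by simp
  have "(\<Sum>S\<in>?S. (norm (\<Sum>j\<in>S. c j))\<^sup>2) = (\<Sum>S\<in>?S. \<Sum>(i,j)\<in>S\<times>S. inner (c i) (c j))"
    by (intro sum.cong refl)
       (simp add: power2_norm_eq_inner inner_sum_left inner_sum_right sum.cartesian_product inner_commute)
  also have "\<dots> = (\<Sum>S\<in>?S. \<Sum>q | q \<in> A \<times> A \<and> q \<in> S \<times> S. inner (c (fst q)) (c (snd q)))"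
    by (intro sum.cong refl) (auto simp: case_prod_unfold)
  also have "\<dots> = (\<Sum>q\<in>A\<times>A. \<Sum>S | S \<in> ?S \<and> q \<in> S \<times> S. inner (c (fst q)) (c (snd q)))"
    using fin assms(1) by (intro sum.swap_restrict) auto
  also have "\<dots> = (\<Sum>(i,j)\<in>A\<times>A. ?N {i, j} * inner (c i) (c j))"
    by (intro sum.cong refl) (auto simp: conj_assoc)
  also have "\<dots> = (\<Sum>i\<in>A. \<Sum>j\<in>A. ?N {i, j} * inner (c i) (c j))"
    by (simp add: sum.cartesian_product)
  also have "\<dots> = (\<Sum>i\<in>A. \<Sum>j\<in>A. M * inner (c i) (c j) + (if j = i then (?p - M) * inner (c i) (c i) else 0))"
  proof (intro sum.cong refl)
    fix i j assume "i \<in> A" "j \<in> A"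
    then show "?N {i, j} * inner (c i) (c j)
        = M * inner (c i) (c j) + (if j = i then (?p - M) * inner (c i) (c i) else 0)"
      using M(2)[of i j] single[of i] by (cases "j = i") (simp_all add: algebra_simps)
  qed
  also have "\<dots> = M * inner (\<Sum>i\<in>A. c i) (\<Sum>j\<in>A. c j) + (\<Sum>i\<in>A. (?p - M) * inner (c i) (c i))"
    using assms(1)
    by (simp add: sum.distrib inner_sum_left inner_sum_right sum_distrib_left inner_commute cong: sum.cong)
  also have "\<dots> = (?p - M) * (\<Sum>i\<in>A. (norm (c i))\<^sup>2)"
    by (simp add: centred sum_distrib_left power2_norm_eq_inner)
  also have "\<dots> \<le> ?p * (\<Sum>i\<in>A. (norm (c i))\<^sup>2)"
    using M(1) by (intro mult_right_mono sum_nonneg) auto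
  finally show ?thesis
    using fin ne by (simp add: integral_pmf_of_set field_simps card_gt_0_iff)
qed

text \<open>Centring cannot increase the sum of squared norms, so a uniform bound on the \<open>d j\<close>
  controls their deviations from the mean as well.\<close>

lemma minibatch_variance:
  fixes d :: "'i \<Rightarrow> 'a::real_inner"
  assumes "finite A" "0 < b" "b \<le> card A" and bound: "\<And>j. j \<in> A \<Longrightarrow> norm (d j) \<le> B"
  defines "dm \<equiv> (1 / real (card A)) *\<^sub>R (\<Sum>j\<in>A. d j)"
  shows "measure_pmf.expectation (pmf_of_set {S. S \<subseteq> A \<and> card S = b})
           (\<lambda>S. (norm ((1 / real b) *\<^sub>R (\<Sum>j\<in>S. d j) - dm))\<^sup>2) \<le> B\<^sup>2 / real b"
    and "measure_pmf.expectation (pmf_of_set {S. S \<subseteq> A \<and> card S = b})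
           (\<lambda>S. inner u ((1 / real b) *\<^sub>R (\<Sum>j\<in>S. d j) - dm)) = 0"
proof -
  let ?S = "{S. S \<subseteq> A \<and> card S = b}"
  have fin: "finite ?S" using assms(1) by simp
  have ne: "?S \<noteq> {}" using assms(3) by (auto elim: obtain_subset_with_card_n)
  have pos: "real (card A) > 0" using assms by linarith
  have centred: "(\<Sum>j\<in>A. d j - dm) = 0"
    using pos by (simp add: sum_subtractf dm_def sum_constant_scaleR)
  have eq: "(1 / real b) *\<^sub>R (\<Sum>j\<in>S. d j) - dm = (1 / real b) *\<^sub>R (\<Sum>j\<in>S. d j - dm)"
    if "S \<in> ?S" for S
    using that assms(2) by (simp add: sum_subtractf sum_constant_scaleR scaleR_diff_right)
  have cong: "measure_pmf.expectation (pmf_of_set ?S) h = measure_pmf.expectation (pmf_of_set ?S) h'"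
    if "\<And>S. S \<in> ?S \<Longrightarrow> h S = h' S" for h h' :: "'i set \<Rightarrow> real"
    using that fin ne by (simp add: integral_pmf_of_set)
  have "(\<Sum>j\<in>A. (norm (d j - dm))\<^sup>2) = (\<Sum>j\<in>A. (norm (d j))\<^sup>2 - 2 * inner dm (d j) + (norm dm)\<^sup>2)"
    by (intro sum.cong refl) (simp add: power2_norm_eq_inner inner_diff inner_commute)
  also have "\<dots> = (\<Sum>j\<in>A. (norm (d j))\<^sup>2) - 2 * inner dm (\<Sum>j\<in>A. d j) + real (card A) * (norm dm)\<^sup>2"
    by (simp add: sum.distrib sum_subtractf sum_distrib_left[symmetric] inner_sum_right)
  also have "(\<Sum>j\<in>A. d j) = real (card A) *\<^sub>R dm" using pos by (simp add: dm_def)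
  also have "(\<Sum>j\<in>A. (norm (d j))\<^sup>2) - 2 * inner dm (real (card A) *\<^sub>R dm) + real (card A) * (norm dm)\<^sup>2
      \<le> (\<Sum>j\<in>A. (norm (d j))\<^sup>2)"
    by (simp add: power2_norm_eq_inner)
  also have "\<dots> \<le> (\<Sum>j\<in>A. B\<^sup>2)"
    using bound by (intro sum_mono power_mono) auto
  finally have V: "(\<Sum>j\<in>A. (norm (d j - dm))\<^sup>2) \<le> real (card A) * B\<^sup>2" by simp
  have "measure_pmf.expectation (pmf_of_set ?S) (\<lambda>S. (norm ((1 / real b) *\<^sub>R (\<Sum>j\<in>S. d j) - dm))\<^sup>2)
      = measure_pmf.expectation (pmf_of_set ?S) (\<lambda>S. (1 / (real b)\<^sup>2) * (norm (\<Sum>j\<in>S. d j - dm))\<^sup>2)"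
    by (intro cong) (simp only: eq, simp add: power_mult_distrib power_divide)
  also have "\<dots> = (1 / (real b)\<^sup>2) * measure_pmf.expectation (pmf_of_set ?S) (\<lambda>S. (norm (\<Sum>j\<in>S. d j - dm))\<^sup>2)"
    by simp
  also have "\<dots> \<le> (1 / (real b)\<^sup>2) * (real b / real (card A) * (\<Sum>j\<in>A. (norm (d j - dm))\<^sup>2))"
    using expectation_norm_centred_subset_sum[OF assms(1-3) centred] by (intro mult_left_mono) auto
  also have "\<dots> \<le> (1 / (real b)\<^sup>2) * (real b / real (card A) * (real (card A) * B\<^sup>2))"
    using V by (intro mult_left_mono) auto
  also have "\<dots> = B\<^sup>2 / real b" using pos assms(2) by (simp add: power2_eq_square)
  finally show "measure_pmf.expectation (pmf_of_set ?S)
      (\<lambda>S. (norm ((1 / real b) *\<^sub>R (\<Sum>j\<in>S. d j) - dm))\<^sup>2) \<le> B\<^sup>2 / real b" .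
  have "measure_pmf.expectation (pmf_of_set ?S) (\<lambda>S. inner u ((1 / real b) *\<^sub>R (\<Sum>j\<in>S. d j) - dm))
      = measure_pmf.expectation (pmf_of_set ?S) (\<lambda>S. \<Sum>j\<in>S. (1 / real b) * inner u (d j - dm))"
    by (intro cong) (simp only: eq, simp add: inner_sum_right sum_distrib_left sum_divide_distrib)
  also have "\<dots> = real b / real (card A) * ((1 / real b) * inner u (\<Sum>j\<in>A. d j - dm))"
    by (simp only: expectation_subset_sum[OF assms(1-3)] inner_sum_right sum_distrib_left)
  finally show "measure_pmf.expectation (pmf_of_set ?S)
      (\<lambda>S. inner u ((1 / real b) *\<^sub>R (\<Sum>j\<in>S. d j) - dm)) = 0"
    by (simp add: centred)
qed

section \<open>Smooth strongly convex functions\<close>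

lemma norm_diff_squared:
  fixes u v :: "'a::real_inner"
  shows "(norm (u - v))\<^sup>2 = (norm u)\<^sup>2 - 2 * inner u v + (norm v)\<^sup>2"
  by (simp add: power2_norm_eq_inner inner_diff_left inner_diff_right inner_commute)

text \<open>The objective as a deterministic function; its components enter only through the
  stochastic gradients.\<close>

locale smooth_strongly_convex =
  fixes F :: "'a::euclidean_space \<Rightarrow> real" and \<mu> L :: real
  assumes mu_pos: "0 < \<mu>" and L_pos: "0 < L"
    and gderiv: "\<And>x. GDERIV F x :> grad F x"
    and strong: "\<And>v w. F w \<ge> F v + inner (grad F v) (w - v) + \<mu> / 2 * (norm (v - w))\<^sup>2"
    and lipschitz: "\<And>v w. norm (grad F v - grad F w) \<le> L * norm (v - w)"
begin

text \<open>Along the segment from \<open>v\<close> to \<open>w\<close>, left side minus right side has nonpositive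
  derivative by the Lipschitz bound on the gradient.\<close>

lemma descent: "F w \<le> F v + inner (grad F v) (w - v) + L / 2 * (norm (w - v))\<^sup>2"
proof -
  define d where "d = w - v"
  define \<phi> where "\<phi> t = F (v + t *\<^sub>R d) - t * inner (grad F v) d - L / 2 * t\<^sup>2 * (norm d)\<^sup>2" for t
  have D: "(\<phi> has_real_derivative
      inner d (grad F (v + t *\<^sub>R d)) - inner (grad F v) d - L * t * (norm d)\<^sup>2) (at t)" for t
  proof -
    have line: "((\<lambda>t. v + t *\<^sub>R d) has_derivative (\<lambda>h. h *\<^sub>R d)) (at t)"
      by (auto intro!: derivative_eq_intros)
    have "(F has_derivative (\<lambda>h. inner h (grad F (v + t *\<^sub>R d)))) (at (v + t *\<^sub>R d))"
      using gderiv by (simp add: gderiv_def)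
    from has_derivative_compose[OF line this]
    have "((\<lambda>t. F (v + t *\<^sub>R d)) has_real_derivative inner d (grad F (v + t *\<^sub>R d))) (at t)"
      by (simp add: has_field_derivative_def mult_commute_abs)
    then show ?thesis unfolding \<phi>_def
      by (auto intro!: derivative_eq_intros simp: algebra_simps)
  qed
  have "\<phi> 1 \<le> \<phi> 0"
  proof (rule DERIV_nonpos_imp_nonincreasing[of 0 1 \<phi>])
    fix t :: real assume t: "0 \<le> t" "t \<le> 1"
    have "inner d (grad F (v + t *\<^sub>R d)) - inner (grad F v) d
        = inner d (grad F (v + t *\<^sub>R d) - grad F v)"
      by (simp add: inner_diff_right inner_commute)
    also have "\<dots> \<le> norm d * norm (grad F (v + t *\<^sub>R d) - grad F v)"
      by (rule norm_cauchy_schwarz)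
    also have "\<dots> \<le> norm d * (L * norm (t *\<^sub>R d))"
      using lipschitz[of "v + t *\<^sub>R d" v] by (intro mult_left_mono) auto
    also have "\<dots> = L * t * (norm d)\<^sup>2" using t by (simp add: power2_eq_square)
    finally show "\<exists>y. (\<phi> has_real_derivative y) (at t) \<and> y \<le> 0"
      using D[of t] by (intro exI conjI) auto
  qed simp
  then show ?thesis by (simp add: \<phi>_def d_def)
qed

text \<open>Compare the strong convexity bound from \<open>z\<close> with the descent bound from \<open>x\<close> at the common
  point \<open>x - y x z /\<^sub>R L\<close>. For \<open>M = 0\<close> this is the cocoercivity of the gradient of a smooth convex
  function. For \<open>M = \<mu>\<close> it keeps both the quadratic term and the gradient term at once, which
  is what the noise estimate requires.\<close>

lemma interpolation:
  assumes M: "0 \<le> M" "M \<le> \<mu>"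
  defines "y \<equiv> \<lambda>x z. grad F x - grad F z - M *\<^sub>R (x - z)"
  shows "F x \<ge> F z + inner (grad F z) (x - z) + M / 2 * (norm (x - z))\<^sup>2 + (norm (y x z))\<^sup>2 / (2 * L)"
proof -
  define Y where "Y = y x z"
  \<comment> \<open>a gradient step from \<open>x\<close> for \<open>F\<close> minus its quadratic lower bound at \<open>z\<close>\<close>
  define u where "u = x - (1 / L) *\<^sub>R Y"
  have "F z + inner (grad F z) (u - z) + M / 2 * (norm (u - z))\<^sup>2
      \<le> F z + inner (grad F z) (u - z) + \<mu> / 2 * (norm (z - u))\<^sup>2"
    using M by (simp add: norm_minus_commute mult_right_mono)
  also have "\<dots> \<le> F u" by (rule strong)
  also have "\<dots> \<le> F x + inner (grad F x) (u - x) + L / 2 * (norm (u - x))\<^sup>2" by (rule descent)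
  also have "L / 2 * (norm (u - x))\<^sup>2 = (norm Y)\<^sup>2 / (2 * L)"
    using L_pos by (simp add: u_def power_mult_distrib power2_eq_square)
  also have "inner (grad F x) (u - x) = - inner (grad F x) Y / L" by (simp add: u_def)
  finally have 1: "F z + inner (grad F z) (u - z) + M / 2 * (norm (u - z))\<^sup>2
      \<le> F x - inner (grad F x) Y / L + (norm Y)\<^sup>2 / (2 * L)" by simp
  have 2: "inner (grad F z) (u - z) = inner (grad F z) (x - z) - inner (grad F z) Y / L"
    by (simp add: u_def inner_diff_right)
  have 3: "(norm (u - z))\<^sup>2 \<ge> (norm (x - z))\<^sup>2 - 2 / L * inner (x - z) Y"
  proof -
    have "u - z = (x - z) - (1 / L) *\<^sub>R Y" by (simp add: u_def)
    then have "(norm (u - z))\<^sup>2 = (norm (x - z))\<^sup>2 - 2 / L * inner (x - z) Y + (norm ((1 / L) *\<^sub>R Y))\<^sup>2"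
      by (simp only: norm_diff_squared[of "x - z"] inner_scaleR_right)
    then show ?thesis by simp
  qed
  have 4: "inner (grad F x) Y - inner (grad F z) Y - M * inner (x - z) Y = (norm Y)\<^sup>2"
    by (simp add: Y_def y_def power2_norm_eq_inner flip: inner_diff_left inner_scaleR_left)
  have "M / 2 * (norm (u - z))\<^sup>2 \<ge> M / 2 * ((norm (x - z))\<^sup>2 - 2 / L * inner (x - z) Y)"
    using 3 M by (intro mult_left_mono) auto
  moreover have "M / 2 * ((norm (x - z))\<^sup>2 - 2 / L * inner (x - z) Y)
      = M / 2 * (norm (x - z))\<^sup>2 - M * inner (x - z) Y / L"
    by (simp add: right_diff_distrib)
  moreover have "inner (grad F x) Y / L - inner (grad F z) Y / L - M * inner (x - z) Y / L
      = 2 * ((norm Y)\<^sup>2 / (2 * L))"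
    using L_pos by (simp add: 4[symmetric] diff_divide_distrib)
  ultimately have "F z + inner (grad F z) (x - z) + M / 2 * (norm (x - z))\<^sup>2 + (norm Y)\<^sup>2 / (2 * L)
      \<le> F x"
    using 1 2 by linarith
  then show ?thesis by (simp add: Y_def)
qed

lemma ex_minimiser: "\<exists>c. \<forall>x. F c \<le> F x"
proof -
  \<comment> \<open>outside this ball the quadratic lower bound at 0 exceeds \<open>F 0\<close>\<close>
  define R where "R = 2 * norm (grad F 0) / \<mu>"
  have R: "0 \<le> R" using mu_pos by (simp add: R_def)
  have "continuous_on (cball 0 R) F"
    by (intro continuous_at_imp_continuous_on ballI
          has_derivative_continuous[OF gderiv[unfolded gderiv_def]])
  then obtain c where c: "c \<in> cball 0 R" "\<And>x. x \<in> cball 0 R \<Longrightarrow> F c \<le> F x"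
    using continuous_attains_inf[of "cball 0 R" F] R by auto
  have "F c \<le> F x" for x
  proof (cases "x \<in> cball 0 R")
    case False
    then have x: "norm x > R" by simp
    have "norm (grad F 0) = \<mu> / 2 * R" using mu_pos by (simp add: R_def)
    also have "\<dots> \<le> \<mu> / 2 * norm x" using x mu_pos by simp
    finally have "norm (grad F 0) * norm x \<le> (\<mu> / 2 * norm x) * norm x"
      by (rule mult_right_mono) simp
    then have "norm (grad F 0) * norm x \<le> \<mu> / 2 * (norm x)\<^sup>2"
      by (simp add: power2_eq_square mult.assoc)
    moreover have "- inner (grad F 0) x \<le> norm (grad F 0) * norm x"
      using norm_cauchy_schwarz[of "- grad F 0" x] by simp
    moreover have "F x \<ge> F 0 + inner (grad F 0) x + \<mu> / 2 * (norm x)\<^sup>2"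
      using strong[of 0 x] by simp
    moreover have "F c \<le> F 0" using c R by simp
    ultimately show ?thesis by linarith
  qed (use c in auto)
  then show ?thesis by blast
qed

lemma arg_min_le: "F (ARG_MIN F x. True) \<le> F x"
proof -
  have "is_arg_min F (\<lambda>_. True) (ARG_MIN F x. True)"
    unfolding arg_min_def
    by (rule someI_ex[of "is_arg_min F (\<lambda>_. True)"]) (simp add: is_arg_min_linorder ex_minimiser)
  then show ?thesis by (simp add: is_arg_min_linorder)
qed

lemma grad_eq_0_if_minimiser:
  assumes "\<And>x. F c \<le> F x"
  shows "grad F c = 0"
proof -
  have "F c \<le> F (c - (1 / L) *\<^sub>R grad F c)" by (rule assms)
  also have "\<dots> \<le> F c - (norm (grad F c))\<^sup>2 / (2 * L)"
    using descent[of "c - (1 / L) *\<^sub>R grad F c" c] L_pos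
    by (simp add: power_mult_distrib power2_eq_square flip: power2_norm_eq_inner)
  finally show ?thesis using L_pos by (simp add: field_simps)
qed

lemma strongly_monotone: "inner (grad F v - grad F w) (v - w) \<ge> \<mu> * (norm (v - w))\<^sup>2"
  using strong[of v w] strong[of w v]
  by (simp add: norm_minus_commute inner_diff_left inner_diff_right algebra_simps)

subsection \<open>The Steffensen--Barzilai--Borwein step size\<close>

text \<open>Multiplying numerator and denominator by \<open>\<beta>\<close> shows that the quotient is
  \<open>(norm d)\<^sup>2 / inner (grad F (x + d) - grad F x) d\<close> for the displacement \<open>d = \<beta> *\<^sub>R grad F x\<close>,
  so neither the size nor the sign of \<open>\<beta>\<close> affects the bounds.\<close>

lemma steffensen_quotient_bounds:
  assumes g: "grad F x \<noteq> 0" and \<beta>: "\<beta> \<noteq> 0"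
  defines "q \<equiv> \<beta> * (norm (grad F x))\<^sup>2 / inner (grad F (x + \<beta> *\<^sub>R grad F x) - grad F x) (grad F x)"
  shows "1 / L \<le> q" "q \<le> 1 / \<mu>"
proof -
  define d where "d = \<beta> *\<^sub>R grad F x"
  define I where "I = inner (grad F (x + d) - grad F x) d"
  have d: "0 < (norm d)\<^sup>2" using g \<beta> by (simp add: d_def)
  have lo: "\<mu> * (norm d)\<^sup>2 \<le> I" using strongly_monotone[of "x + d" x] by (simp add: I_def)
  have "I \<le> norm (grad F (x + d) - grad F x) * norm d" unfolding I_def by (rule norm_cauchy_schwarz)
  also have "\<dots> \<le> L * norm d * norm d"
    using lipschitz[of "x + d" x] by (intro mult_right_mono) auto
  finally have hi: "I \<le> L * (norm d)\<^sup>2" by (simp add: power2_eq_square mult.assoc)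
  have I: "0 < I" using lo d mu_pos by (smt (verit) mult_pos_pos)
  have "q = (norm d)\<^sup>2 / I"
  proof -
    have "I = \<beta> * inner (grad F (x + \<beta> *\<^sub>R grad F x) - grad F x) (grad F x)"
      by (simp add: I_def d_def)
    moreover have "(norm d)\<^sup>2 = \<beta> * (\<beta> * (norm (grad F x))\<^sup>2)"
      by (simp add: d_def power_mult_distrib power2_eq_square[of \<beta>])
    ultimately show ?thesis using \<beta> by (simp add: q_def)
  qed
  then show "1 / L \<le> q" "q \<le> 1 / \<mu>"
    using lo hi I mu_pos L_pos by (simp_all add: pos_le_divide_eq pos_divide_le_eq mult.commute)
qed

lemma bb_beta_nonzero: "bb_beta F k xp x \<noteq> 0"
proof (cases "k = 0 \<or> x = xp")
  case False
  then have "0 < \<mu> * (norm (x - xp))\<^sup>2" using mu_pos by simp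
  with strongly_monotone[of x xp] have "inner (x - xp) (grad F x - grad F xp) > 0"
    by (simp add: inner_commute)
  with False show ?thesis by (simp add: bb_beta_def Let_def)
qed (auto simp: bb_beta_def)

lemma steffensen_eta_bounds:
  assumes "grad F x \<noteq> 0" "\<beta> \<noteq> 0"
  shows "real b / (real m * L) \<le> steffensen_eta F m b e \<beta> x"
    "steffensen_eta F m b e \<beta> x \<le> real b / (real m * \<mu>)"
proof -
  have b: "0 \<le> real b / real m" by simp
  have lo: "real b / (real m * L) = real b / real m * (1 / L)"
    and hi: "real b / (real m * \<mu>) = real b / real m * (1 / \<mu>)" by simp_all
  show "real b / (real m * L) \<le> steffensen_eta F m b e \<beta> x"
    unfolding lo steffensen_eta_def if_not_P[OF assms(1)]
    by (intro mult_left_mono[OF _ b] steffensen_quotient_bounds(1)[OF assms(1,2)])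
  show "steffensen_eta F m b e \<beta> x \<le> real b / (real m * \<mu>)"
    unfolding hi steffensen_eta_def if_not_P[OF assms(1)]
    by (intro mult_left_mono[OF _ b] steffensen_quotient_bounds(2)[OF assms(1,2)])
qed

subsection \<open>A Lyapunov function for variance-reduced steps\<close>

text \<open>The first term on the left is the mean part of the potential after one step, the second
  one is the variance of that step. The variance is bounded by interpolation at
  \<open>(x, z)\<close>. The term \<open>inner (grad F z) (a x)\<close> that this produces cancels against the first-order
  change of the squared distance caused by moving its centre from \<open>c\<close> to \<open>c + Q *\<^sub>R a x\<close>. What
  is left is handled by cocoercivity at \<open>z\<close>: \<open>\<eta> \<le> 1 / L\<close> lets it absorb the squared gradient.\<close>

lemma shifted_distance_drift:
  assumes c: "grad F c = 0"
    and \<eta>: "0 < \<eta>" "\<eta> \<le> 1 / L"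
    and Q: "0 \<le> Q" "Q * (1 + \<mu> / L) \<le> 1"
  defines "a \<equiv> \<lambda>x. (x - c) - (1 / L) *\<^sub>R (grad F x - \<mu> *\<^sub>R (x - c))"
  shows "(norm (z - \<eta> *\<^sub>R grad F z - (c + Q *\<^sub>R a x)))\<^sup>2 + \<eta> * Q * \<mu> * (norm (z - x))\<^sup>2
    \<le> (norm (z - (c + Q *\<^sub>R a x)))\<^sup>2 - 2 * \<eta> * (1 - 2 * Q * \<mu> / L) * (F z - F c)
      + 2 * \<eta> * Q * (F x - F c)"
proof -
  define g where "g = grad F z"
  define h where "h = grad F x - \<mu> *\<^sub>R (x - c)"
  define Z where "Z = z - c"
  define X where "X = x - c"
  define w where "w = inner g Z"
  define \<delta> where "\<delta> = F z - F c"
  define G where "G = (norm g)\<^sup>2"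
  have G0: "0 \<le> G" by (simp add: G_def)
  have w: "w \<ge> \<delta> + G / (2 * L)"
    using interpolation[of 0 z c] mu_pos c
    by (simp add: w_def \<delta>_def G_def g_def Z_def inner_diff_right)
  have G: "G \<le> 2 * L * \<delta>"
    using interpolation[of 0 c z] mu_pos L_pos c
    by (simp add: \<delta>_def G_def g_def field_simps)
  \<comment> \<open>interpolation at \<open>(x, z)\<close>; the part of \<open>(norm Y)\<^sup>2\<close> with no sign enters \<open>a x\<close>, and
    completing the square in \<open>h\<close> leaves a remainder of relative size \<open>\<mu> / L\<close>\<close>
  have noise: "\<mu> * (norm (z - x))\<^sup>2
      \<le> 2 * (F x - F c - \<delta>) + 2 * w - 2 * inner g (a x) + (2 * \<mu> * w - G) / L"
  proof -
    define Y where "Y = h - (g - \<mu> *\<^sub>R Z)"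
    have Y: "grad F x - grad F z - \<mu> *\<^sub>R (x - z) = Y"
      by (simp add: Y_def h_def g_def Z_def algebra_simps)
    have "Y = (h + \<mu> *\<^sub>R Z) - g" by (simp add: Y_def)
    then have "(norm Y)\<^sup>2 = (norm (h + \<mu> *\<^sub>R Z))\<^sup>2 + G - 2 * inner g h - 2 * \<mu> * w"
      by (simp only: norm_diff_squared)
        (simp add: G_def w_def inner_add_left inner_commute[of h] inner_commute[of Z])
    then have Yge: "(norm Y)\<^sup>2 \<ge> G - 2 * inner g h - 2 * \<mu> * w" by simp
    have "F x \<ge> F z + inner g (x - z) + \<mu> / 2 * (norm (x - z))\<^sup>2 + (norm Y)\<^sup>2 / (2 * L)"
      using interpolation[of \<mu> z x] mu_pos unfolding Y g_def by simp
    moreover have "(norm Y)\<^sup>2 / (2 * L) \<ge> (G - 2 * inner g h - 2 * \<mu> * w) / (2 * L)"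
      using Yge L_pos by (intro divide_right_mono) auto
    moreover have "(G - 2 * inner g h - 2 * \<mu> * w) / (2 * L) = - inner g h / L - (2 * \<mu> * w - G) / L / 2"
      using L_pos by (simp add: field_simps)
    moreover have "inner g (x - z) = inner g X - w" by (simp add: w_def X_def Z_def inner_diff_right)
    moreover have "inner g (a x) = inner g X - inner g h / L"
      by (simp add: a_def h_def X_def inner_diff_right)
    ultimately show ?thesis by (simp add: \<delta>_def norm_minus_commute)
  qed
  have expand: "(norm (z - \<eta> *\<^sub>R grad F z - (c + Q *\<^sub>R a x)))\<^sup>2
      = (norm (z - (c + Q *\<^sub>R a x)))\<^sup>2 - 2 * \<eta> * (w - Q * inner g (a x)) + \<eta>\<^sup>2 * G"
  proof -
    have split: "z - \<eta> *\<^sub>R grad F z - (c + Q *\<^sub>R a x) = (z - (c + Q *\<^sub>R a x)) - \<eta> *\<^sub>R g"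
      by (simp add: g_def algebra_simps)
    have "inner (z - (c + Q *\<^sub>R a x)) g = w - Q * inner g (a x)"
      by (simp add: w_def Z_def inner_diff_left inner_add_right inner_diff_right inner_commute[of _ g])
    then show ?thesis
      unfolding split norm_diff_squared[of "z - (c + Q *\<^sub>R a x)"]
      by (simp add: G_def power_mult_distrib)
  qed
  define k where "k = \<mu> / L"
  define G' where "G' = G / L"
  have k: "0 \<le> k" using mu_pos L_pos by (simp add: k_def)
  have noise': "\<mu> * (norm (z - x))\<^sup>2
      \<le> 2 * (F x - F c - \<delta>) + 2 * w - 2 * inner g (a x) + (2 * k * w - G')"
    using noise by (simp add: k_def G'_def diff_divide_distrib)
  have N: "\<eta> * Q * (\<mu> * (norm (z - x))\<^sup>2)
      \<le> \<eta> * Q * (2 * (F x - F c - \<delta>) + 2 * w - 2 * inner g (a x) + (2 * k * w - G'))"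
    using noise' \<eta> Q by (intro mult_left_mono) auto
  have A: "0 \<le> \<eta> * ((2 * w - 2 * \<delta> - G') * (1 - Q * (1 + k)))"
    using w Q \<eta> by (intro mult_nonneg_nonneg) (auto simp: G'_def k_def)
  have B: "0 \<le> \<eta> * Q * k * (2 * \<delta> - G')"
    using G \<eta> Q k L_pos by (intro mult_nonneg_nonneg) (auto simp: G'_def field_simps)
  have "\<eta> * G \<le> 1 / L * G" using \<eta> G0 by (intro mult_right_mono) auto
  then have C: "\<eta> * (\<eta> * G) \<le> \<eta> * G'" using \<eta> by (intro mult_left_mono) (auto simp: G'_def)
  have R: "2 * \<eta> * (1 - 2 * Q * \<mu> / L) * (F z - F c) = 2 * \<eta> * (1 - 2 * Q * k) * \<delta>"
    by (simp add: k_def \<delta>_def)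
  define U where "U = (norm (z - x))\<^sup>2"
  define s where "s = inner g (a x)"
  define P where "P = (norm (z - (c + Q *\<^sub>R a x)))\<^sup>2"
  define D where "D = F x - F c"
  \<comment> \<open>the slack of the claim is exactly the sum of the slacks in \<open>A\<close>, \<open>B\<close>, \<open>C\<close> and \<open>N\<close>\<close>
  have "P - 2 * \<eta> * (1 - 2 * Q * k) * \<delta> + 2 * \<eta> * Q * D
        - (P - 2 * \<eta> * (w - Q * s) + \<eta>\<^sup>2 * G + \<eta> * Q * \<mu> * U)
      = \<eta> * ((2 * w - 2 * \<delta> - G') * (1 - Q * (1 + k))) + \<eta> * Q * k * (2 * \<delta> - G')
        + (\<eta> * G' - \<eta> * (\<eta> * G))
        + (\<eta> * Q * (2 * (D - \<delta>) + 2 * w - 2 * s + (2 * k * w - G')) - \<eta> * Q * (\<mu> * U))"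
    by algebra
  with N A B C show ?thesis
    unfolding expand R U_def[symmetric] s_def[symmetric] P_def[symmetric] D_def[symmetric]
    by linarith
qed

text \<open>The vector \<open>x - (c + Q *\<^sub>R a x)\<close> is a convex combination of \<open>x - c\<close> and \<open>h /\<^sub>R L\<close>, where
  \<open>h = grad F x - \<mu> *\<^sub>R (x - c)\<close> is the gradient of the convex function obtained by removing the quadratic \<open>\<mu> / 2 * (norm (x - c))\<^sup>2\<close>.
  That function is again \<open>L\<close>-smooth with critical point \<open>c\<close>, so \<open>norm h \<le> L * norm (x - c)\<close> and
  shifting the centre does not lengthen the distance.\<close>

lemma shifted_distance_start:
  assumes c: "grad F c = 0" and Q: "0 \<le> Q" "Q \<le> 1"
  defines "a \<equiv> \<lambda>x. (x - c) - (1 / L) *\<^sub>R (grad F x - \<mu> *\<^sub>R (x - c))"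
  shows "(norm (x - (c + Q *\<^sub>R a x)))\<^sup>2 \<le> 2 / \<mu> * (F x - F c)"
proof -
  define X where "X = x - c"
  define h where "h = grad F x - \<mu> *\<^sub>R X"
  have mono: "inner (grad F x) X \<ge> \<mu> * (norm X)\<^sup>2"
    using strongly_monotone[of x c] c by (simp add: X_def)
  have "(norm h)\<^sup>2 = (norm (grad F x))\<^sup>2 - 2 * \<mu> * inner (grad F x) X + \<mu>\<^sup>2 * (norm X)\<^sup>2"
    by (simp add: h_def norm_diff_squared power_mult_distrib)
  also have "\<dots> \<le> (norm (grad F x))\<^sup>2"
  proof -
    have "\<mu> * (\<mu> * (norm X)\<^sup>2) \<le> \<mu> * inner (grad F x) X"
      using mono mu_pos by (intro mult_left_mono) auto
    moreover have "0 \<le> \<mu> * (\<mu> * (norm X)\<^sup>2)" using mu_pos by simp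
    moreover have "\<mu>\<^sup>2 * (norm X)\<^sup>2 = \<mu> * (\<mu> * (norm X)\<^sup>2)"
      by (simp add: power2_eq_square mult.assoc)
    ultimately show ?thesis by linarith
  qed
  finally have "norm h \<le> norm (grad F x)" by (rule power2_le_imp_le) simp
  also have "\<dots> \<le> L * norm X" using lipschitz[of x c] c by (simp add: X_def)
  finally have h: "norm h \<le> L * norm X" .
  have "x - (c + Q *\<^sub>R a x) = (1 - Q) *\<^sub>R X + (Q / L) *\<^sub>R h"
    by (simp add: a_def h_def X_def algebra_simps)
  then have "norm (x - (c + Q *\<^sub>R a x)) \<le> norm ((1 - Q) *\<^sub>R X) + norm ((Q / L) *\<^sub>R h)"
    by (metis norm_triangle_ineq)
  also have "\<dots> \<le> (1 - Q) * norm X + Q / L * (L * norm X)"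
    using Q L_pos mult_left_mono[OF h, of "Q / L"] by simp
  also have "\<dots> = norm X" using L_pos by (simp add: algebra_simps)
  finally have "(norm (x - (c + Q *\<^sub>R a x)))\<^sup>2 \<le> (norm X)\<^sup>2" by (intro power_mono) auto
  also have "\<dots> \<le> 2 / \<mu> * (F x - F c)"
    using strong[of c x] c mu_pos by (simp add: X_def norm_minus_commute field_simps)
  finally show ?thesis .
qed

end

section \<open>Expectations along the sampled iterates\<close>

lemma expectation_bind_pmf_finite:
  fixes h :: "'b \<Rightarrow> real"
  assumes "finite (set_pmf p)" "\<And>x. x \<in> set_pmf p \<Longrightarrow> finite (set_pmf (q x))"
  shows "measure_pmf.expectation (bind_pmf p q) h
    = measure_pmf.expectation p (\<lambda>x. measure_pmf.expectation (q x) h)"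
  using pmf_expectation_bind[of "set_pmf p" q p h] assms
    integral_measure_pmf[of "set_pmf p" p "\<lambda>x. measure_pmf.expectation (q x) h"] by simp

lemma expectation_mono_finite:
  fixes g h :: "'b \<Rightarrow> real"
  assumes "finite (set_pmf p)" "\<And>x. x \<in> set_pmf p \<Longrightarrow> g x \<le> h x"
  shows "measure_pmf.expectation p g \<le> measure_pmf.expectation p h"
  using assms by (intro integral_mono_AE integrable_measure_pmf_finite) (auto simp: AE_measure_pmf_iff)

text \<open>The inner step as a function of the sampled minibatch \<open>S\<close>, separated from the sampling.\<close>

definition svrg_update ::
    "nat \<Rightarrow> nat \<Rightarrow> (nat \<Rightarrow> 'a::real_inner \<Rightarrow> real) \<Rightarrow> real \<Rightarrow> 'a \<Rightarrow> 'a \<Rightarrow> nat set \<Rightarrow> 'a" where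
  "svrg_update n b f \<eta> x z S =
    z - \<eta> *\<^sub>R (minibatch_grad b f S z - minibatch_grad b f S x + grad (objective n f) x)"

definition uniform_minibatch :: "nat \<Rightarrow> nat \<Rightarrow> nat set pmf" where
  "uniform_minibatch n b = pmf_of_set {S. S \<subseteq> {1..n} \<and> card S = b}"

lemma inner_path_Suc:
  "inner_path n b f \<eta> x (Suc t) = bind_pmf (inner_path n b f \<eta> x t)
    (\<lambda>xs. map_pmf (\<lambda>S. xs @ [svrg_update n b f \<eta> x (last xs) S]) (uniform_minibatch n b))"
  by (simp add: svrg_update_def uniform_minibatch_def map_pmf_def Let_def)

declare inner_path.simps(2) [simp del]

lemma finite_set_pmf_uniform_minibatch:
  assumes "b \<le> n" shows "finite (set_pmf (uniform_minibatch n b))"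
proof -
  have "{S. S \<subseteq> {1..n} \<and> card S = b} \<noteq> {}"
    using assms obtain_subset_with_card_n[of b "{1..n}"] by auto
  then have "set_pmf (uniform_minibatch n b) = {S. S \<subseteq> {1..n} \<and> card S = b}"
    unfolding uniform_minibatch_def by (intro set_pmf_of_set) auto
  then show ?thesis by simp
qed

lemma finite_set_pmf_inner_path:
  assumes "b \<le> n" shows "finite (set_pmf (inner_path n b f \<eta> x t))"
  by (induction t) (simp_all add: inner_path_Suc finite_set_pmf_uniform_minibatch[OF assms])

lemma length_inner_path:
  "xs \<in> set_pmf (inner_path n b f \<eta> x t) \<Longrightarrow> length xs = Suc t"
  by (induction t arbitrary: xs) (auto simp: inner_path_Suc)

lemma finite_set_pmf_outer_step:
  assumes "b \<le> n" "0 < m" shows "finite (set_pmf (outer_step n m b f \<eta> x))"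
  using assms by (simp add: outer_step_def finite_set_pmf_inner_path set_pmf_of_set)

lemma finite_set_pmf_ssbb_pair:
  assumes "b \<le> n" "0 < m" shows "finite (set_pmf (ssbb_pair n m b f e x0 k))"
  by (induction k) (auto simp: Let_def finite_set_pmf_outer_step[OF assms])

text \<open>A one-step estimate of the potential \<open>V\<close>, telescoped along the path. The sum omits the last
  iterate, so that for \<open>t = m\<close> it ranges over exactly the iterates among which the next outer
  iterate is drawn.\<close>

lemma inner_path_potential:
  assumes b: "b \<le> n"
    and step: "\<And>z. measure_pmf.expectation (uniform_minibatch n b)
        (\<lambda>S. V (svrg_update n b f \<eta> x z S)) + A * \<delta> z \<le> V z + C"
  shows "measure_pmf.expectation (inner_path n b f \<eta> x t)
      (\<lambda>xs. V (last xs) + A * (\<Sum>i<t. \<delta> (xs ! i))) \<le> V x + real t * C"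
proof (induction t)
  case 0
  show ?case by simp
next
  case (Suc t)
  let ?P = "inner_path n b f \<eta> x t"
  let ?S = "uniform_minibatch n b"
  let ?u = "svrg_update n b f \<eta> x"
  have finS: "finite (set_pmf ?S)" by (rule finite_set_pmf_uniform_minibatch[OF b])
  have finP: "finite (set_pmf ?P)" by (rule finite_set_pmf_inner_path[OF b])
  have "measure_pmf.expectation (inner_path n b f \<eta> x (Suc t))
      (\<lambda>xs. V (last xs) + A * (\<Sum>i<Suc t. \<delta> (xs ! i)))
    = measure_pmf.expectation ?P (\<lambda>xs. measure_pmf.expectation ?S
        (\<lambda>S. V (?u (last xs) S) + A * (\<Sum>i<Suc t. \<delta> ((xs @ [?u (last xs) S]) ! i))))"
    using finP finS by (simp add: inner_path_Suc expectation_bind_pmf_finite)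
  also have "\<dots> \<le> measure_pmf.expectation ?P
      (\<lambda>xs. V (last xs) + A * (\<Sum>i<t. \<delta> (xs ! i)) + C)"
  proof (rule expectation_mono_finite[OF finP])
    fix xs assume "xs \<in> set_pmf ?P"
    then have len: "length xs = Suc t" by (rule length_inner_path)
    have last: "xs ! t = last xs" using len by (metis diff_Suc_1 last_conv_nth list.size(3) nat.distinct(1))
    have sum: "(\<Sum>i<Suc t. \<delta> ((xs @ [y]) ! i)) = (\<Sum>i<t. \<delta> (xs ! i)) + \<delta> (last xs)" for y
      using len last by (simp add: nth_append)
    have "measure_pmf.expectation ?S
        (\<lambda>S. V (?u (last xs) S) + A * (\<Sum>i<Suc t. \<delta> ((xs @ [?u (last xs) S]) ! i)))
      = measure_pmf.expectation ?S (\<lambda>S. V (?u (last xs) S))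
        + A * ((\<Sum>i<t. \<delta> (xs ! i)) + \<delta> (last xs))"
      unfolding sum using finS by (simp add: integrable_measure_pmf_finite)
    also have "\<dots> \<le> V (last xs) + A * (\<Sum>i<t. \<delta> (xs ! i)) + C"
      using step[of "last xs"] by (simp add: algebra_simps)
    finally show "measure_pmf.expectation ?S
        (\<lambda>S. V (?u (last xs) S) + A * (\<Sum>i<Suc t. \<delta> ((xs @ [?u (last xs) S]) ! i)))
      \<le> V (last xs) + A * (\<Sum>i<t. \<delta> (xs ! i)) + C" .
  qed
  also have "\<dots> = measure_pmf.expectation ?P (\<lambda>xs. V (last xs) + A * (\<Sum>i<t. \<delta> (xs ! i))) + C"
    using finP by (simp add: integrable_measure_pmf_finite)
  also have "\<dots> \<le> V x + real (Suc t) * C" using Suc.IH by (simp add: algebra_simps)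
  finally show ?case .
qed

lemma expectation_outer_step:
  fixes h :: "'a::real_inner \<Rightarrow> real"
  assumes "b \<le> n" "0 < m"
  shows "measure_pmf.expectation (outer_step n m b f \<eta> x) h
    = measure_pmf.expectation (inner_path n b f \<eta> x m) (\<lambda>xs. (\<Sum>i<m. h (xs ! i))) / real m"
proof -
  have "outer_step n m b f \<eta> x
      = bind_pmf (inner_path n b f \<eta> x m) (\<lambda>xs. map_pmf ((!) xs) (pmf_of_set {0..<m}))"
    by (simp add: outer_step_def map_pmf_def)
  moreover have "finite (set_pmf (map_pmf ((!) xs) (pmf_of_set {0..<m})))" for xs :: "'a list"
    using assms(2) by (simp add: set_pmf_of_set)
  moreover have "measure_pmf.expectation (map_pmf ((!) xs) (pmf_of_set {0..<m})) h
      = (\<Sum>i<m. h (xs ! i)) / real m" for xs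
    using assms(2) integral_pmf_of_set[of "{0..<m}" "\<lambda>i. h (xs ! i)"]
    by (simp add: atLeast0LessThan lessThan_empty_iff)
  ultimately show ?thesis
    by (simp only: expectation_bind_pmf_finite[OF finite_set_pmf_inner_path[OF assms(1)]])
      simp
qed

section \<open>Contraction in one outer step\<close>

text \<open>The difference of the two sides is \<open>(\<theta> - 1) * (r / \<theta> - p)\<close>: as long as
  \<open>\<theta> * p \<le> r\<close>, a longer step shrinks the initial distance term by more than it
  adds in noise, so the smallest step is the worst one.\<close>

lemma step_size_tradeoff:
  fixes \<theta> \<kappa> r p :: real
  assumes "1 \<le> \<theta>" "\<theta> \<le> \<kappa>" "0 \<le> p" "\<kappa> * p \<le> r"
  shows "r / \<theta> + \<theta> * p \<le> r + p"
proof -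
  have "\<theta> * p \<le> r" using mult_right_mono[OF assms(2,3)] assms(4) by simp
  then have "0 \<le> (\<theta> - 1) * (r / \<theta> - p)"
    using assms(1) by (intro mult_nonneg_nonneg) (auto simp: pos_le_divide_eq mult.commute)
  also have "\<dots> = r + p - (r / \<theta> + \<theta> * p)" using assms(1) by (simp add: field_simps)
  finally show ?thesis by simp
qed

locale smooth_finite_sum =
  fixes f :: "nat \<Rightarrow> 'a::euclidean_space \<Rightarrow> real" and n :: nat and \<mu> L :: real
  assumes n_pos: "0 < n" and mu: "0 < \<mu>" and L: "0 < L"
    and diff: "\<And>i v. i \<in> {1..n} \<Longrightarrow> f i differentiable at v"
    and strong_objective: "\<And>v w. objective n f w \<ge> objective n f v
      + inner (grad (objective n f) v) (w - v) + \<mu> / 2 * (norm (v - w))\<^sup>2"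
    and smooth: "\<And>i v w. i \<in> {1..n} \<Longrightarrow> norm (grad (f i) v - grad (f i) w) \<le> L * norm (v - w)"
begin

abbreviation F :: "'a \<Rightarrow> real" where "F \<equiv> objective n f"

lemma GDERIV_objective: "GDERIV F x :> (1 / real n) *\<^sub>R (\<Sum>i=1..n. grad (f i) x)"
proof -
  have "((\<lambda>x. (1 / real n) * (\<Sum>i=1..n. f i x)) has_derivative
      (\<lambda>h. (1 / real n) * (\<Sum>i=1..n. inner h (grad (f i) x)))) (at x)"
    using GDERIV_grad[OF diff] by (intro has_derivative_mult_right has_derivative_sum) (auto simp: gderiv_def)
  then show ?thesis
    by (simp add: gderiv_def objective_def[abs_def] inner_sum_right)
qed

lemma grad_objective: "grad F x = (1 / real n) *\<^sub>R (\<Sum>i=1..n. grad (f i) x)"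
  using GDERIV_objective by (rule grad_eqI)

lemma lipschitz_objective: "norm (grad F v - grad F w) \<le> L * norm (v - w)"
proof -
  have "grad F v - grad F w = (1 / real n) *\<^sub>R (\<Sum>i=1..n. grad (f i) v - grad (f i) w)"
    by (simp add: grad_objective sum_subtractf scaleR_diff_right)
  also have "norm \<dots> \<le> (1 / real n) * (\<Sum>i=1..n. L * norm (v - w))"
  proof -
    have "norm (\<Sum>i=1..n. grad (f i) v - grad (f i) w) \<le> (\<Sum>i=1..n. L * norm (v - w))"
      using smooth by (rule sum_norm_le)
    then show ?thesis
      unfolding norm_scaleR by (intro mult_mono) auto
  qed
  also have "\<dots> = L * norm (v - w)" using n_pos by simp
  finally show ?thesis .
qed

sublocale smooth_strongly_convex "objective n f" \<mu> L
  using mu L strong_objective lipschitz_objective GDERIV_objective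
  by unfold_locales (simp_all add: grad_objective)

text \<open>The step is unbiased, so the squared distance to any point \<open>p\<close> splits into its value for the
  full gradient step and the variance. The variance is bounded by the Lipschitz
  estimate for each component gradient between \<open>z\<close> and \<open>x\<close>.\<close>

lemma svrg_step_variance:
  assumes "0 < b" "b \<le> n"
  shows "measure_pmf.expectation (uniform_minibatch n b)
      (\<lambda>S. (norm (svrg_update n b f \<eta> x z S - p))\<^sup>2)
    \<le> (norm (z - \<eta> *\<^sub>R grad F z - p))\<^sup>2 + \<eta>\<^sup>2 * L\<^sup>2 / real b * (norm (z - x))\<^sup>2"
proof -
  let ?S = "uniform_minibatch n b"
  define d where "d j = grad (f j) z - grad (f j) x" for j
  define dm where "dm = (1 / real (card {1..n})) *\<^sub>R (\<Sum>j\<in>{1..n}. d j)"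
  define D where "D S = (1 / real b) *\<^sub>R (\<Sum>j\<in>S. d j) - dm" for S
  define u where "u = z - \<eta> *\<^sub>R grad F z - p"
  have fin: "finite (set_pmf ?S)" using assms by (intro finite_set_pmf_uniform_minibatch)
  have dm: "dm = grad F z - grad F x"
    by (simp add: dm_def d_def grad_objective sum_subtractf scaleR_diff_right)
  have upd: "svrg_update n b f \<eta> x z S - p = u - \<eta> *\<^sub>R D S" for S
    by (simp add: svrg_update_def D_def u_def dm d_def minibatch_grad_def sum_subtractf
          scaleR_diff_right scaleR_add_right)
  have var: "measure_pmf.expectation ?S (\<lambda>S. (norm (D S))\<^sup>2) \<le> (L * norm (z - x))\<^sup>2 / real b"
    unfolding D_def dm_def uniform_minibatch_def using assms smooth by (intro minibatch_variance) (auto simp: d_def)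
  have mean: "measure_pmf.expectation ?S (\<lambda>S. inner u (D S)) = 0"
    unfolding D_def dm_def uniform_minibatch_def using assms smooth by (intro minibatch_variance) (auto simp: d_def)
  have "(norm (u - \<eta> *\<^sub>R D S))\<^sup>2 = (norm u)\<^sup>2 - 2 * \<eta> * inner u (D S) + \<eta>\<^sup>2 * (norm (D S))\<^sup>2" for S
    by (simp add: norm_diff_squared power_mult_distrib)
  then have "measure_pmf.expectation ?S (\<lambda>S. (norm (svrg_update n b f \<eta> x z S - p))\<^sup>2)
      = (norm u)\<^sup>2 - 2 * \<eta> * measure_pmf.expectation ?S (\<lambda>S. inner u (D S))
        + \<eta>\<^sup>2 * measure_pmf.expectation ?S (\<lambda>S. (norm (D S))\<^sup>2)"
    unfolding upd using fin by (simp add: integrable_measure_pmf_finite)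
  also have "\<dots> \<le> (norm u)\<^sup>2 + \<eta>\<^sup>2 * ((L * norm (z - x))\<^sup>2 / real b)"
    using mean mult_left_mono[OF var, of "\<eta>\<^sup>2"] by simp
  finally show ?thesis by (simp add: u_def power_mult_distrib mult.assoc)
qed

text \<open>At a stationary point the control variate cancels the minibatch gradient exactly, so every
  inner iterate stays there, whatever the step size.\<close>

lemma outer_step_stationary:
  assumes "grad F x = 0" "0 < m" "b \<le> n"
  shows "outer_step n m b f \<eta> x = return_pmf x"
proof -
  have "svrg_update n b f \<eta> x x S = x" for S using assms by (simp add: svrg_update_def)
  then have path: "inner_path n b f \<eta> x t = return_pmf (replicate (Suc t) x)" for t
    by (induction t)
      (simp_all add: inner_path_Suc bind_return_pmf replicate_append_same map_pmf_const)
  have "outer_step n m b f \<eta> x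
      = bind_pmf (pmf_of_set {0..<m}) (\<lambda>i. return_pmf (replicate (Suc m) x ! i))"
    by (simp only: outer_step_def path bind_return_pmf)
  also have "\<dots> = bind_pmf (pmf_of_set {0..<m}) (\<lambda>i. return_pmf x)"
    using assms(2) by (intro bind_pmf_cong refl) (simp add: set_pmf_of_set del: replicate_Suc)
  finally show ?thesis by simp
qed

text \<open>Here \<open>Q\<close> is chosen so that the variance \<open>\<eta>\<^sup>2 * L\<^sup>2 / b * (norm (z - x))\<^sup>2\<close> equals
  \<open>\<eta> * Q * \<mu> * (norm (z - x))\<^sup>2\<close>, the amount that the drift estimate can absorb.\<close>

lemma outer_step_bound:
  assumes m: "0 < m" and b: "0 < b" "b \<le> n" and c: "\<And>x. F c \<le> F x"
    and \<eta>: "0 < \<eta>" "\<eta> \<le> 1 / L"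
    and Q: "Q = \<eta> * L\<^sup>2 / (real b * \<mu>)" "Q * (1 + \<mu> / L) \<le> 1"
  shows "(1 - 2 * Q * \<mu> / L) * measure_pmf.expectation (outer_step n m b f \<eta> x) (\<lambda>x. F x - F c)
    \<le> (1 / (\<mu> * \<eta> * real m) + Q) * (F x - F c)"
proof -
  have gc: "grad F c = 0" using c by (rule grad_eq_0_if_minimiser)
  have Q0: "0 \<le> Q" using \<eta> mu by (simp add: Q(1))
  have "Q * 1 \<le> Q * (1 + \<mu> / L)" using Q0 mu L by (intro mult_left_mono) auto
  with Q have Q1: "Q \<le> 1" by simp
  define p where "p = c + Q *\<^sub>R ((x - c) - (1 / L) *\<^sub>R (grad F x - \<mu> *\<^sub>R (x - c)))"
  define V where "V z = (norm (z - p))\<^sup>2" for z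
  define A where "A = 2 * \<eta> * (1 - 2 * Q * \<mu> / L)"
  define \<Delta> where "\<Delta> = F x - F c"
  define E where "E = measure_pmf.expectation (outer_step n m b f \<eta> x) (\<lambda>x. F x - F c)"
  let ?P = "inner_path n b f \<eta> x m"
  have finP: "finite (set_pmf ?P)" using b by (intro finite_set_pmf_inner_path)
  have noise: "\<eta>\<^sup>2 * L\<^sup>2 / real b = \<eta> * Q * \<mu>" using mu b by (simp add: Q(1) power2_eq_square)
  have step: "measure_pmf.expectation (uniform_minibatch n b)
      (\<lambda>S. V (svrg_update n b f \<eta> x z S)) + A * (F z - F c) \<le> V z + 2 * \<eta> * Q * \<Delta>" for z
    using svrg_step_variance[OF b, of \<eta> x z p] shifted_distance_drift[OF gc \<eta> Q0 Q(2), of z x]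
    unfolding noise V_def A_def \<Delta>_def p_def by simp
  \<comment> \<open>the uniform choice of \<open>i < m\<close> turns the expected suboptimality into the mean of the summed decrease\<close>
  have "A * (real m * E) = measure_pmf.expectation ?P (\<lambda>xs. A * (\<Sum>i<m. F (xs ! i) - F c))"
    using m b by (simp add: E_def expectation_outer_step)
  also have "\<dots> \<le> measure_pmf.expectation ?P (\<lambda>xs. V (last xs) + A * (\<Sum>i<m. F (xs ! i) - F c))"
    by (intro expectation_mono_finite[OF finP]) (simp add: V_def)
  also have "\<dots> \<le> V x + real m * (2 * \<eta> * Q * \<Delta>)"
    using inner_path_potential[OF b(2) step] .
  also have "V x \<le> 2 / \<mu> * \<Delta>"
    using shifted_distance_start[OF gc Q0 Q1, of x] by (simp add: V_def p_def \<Delta>_def)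
  finally have "A * (real m * E) \<le> 2 / \<mu> * \<Delta> + real m * (2 * \<eta> * Q * \<Delta>)" by simp
  then have "2 * \<eta> * real m * ((1 - 2 * Q * \<mu> / L) * E)
      \<le> 2 * \<eta> * real m * ((1 / (\<mu> * \<eta> * real m) + Q) * \<Delta>)"
    using \<eta> m mu by (simp add: A_def algebra_simps)
  then show ?thesis using \<eta> m unfolding E_def \<Delta>_def
    by (subst (asm) mult_le_cancel_left_pos) auto
qed

text \<open>With \<open>r = \<kappa> / b\<close> and \<open>p = \<kappa> / m\<close>, the rate is \<open>\<rho> = (r + 4 * p * (1 + 1 / m)) / (1 - 4 * p)\<close>,
  whereas one outer step contracts already by \<open>(r + p) / (1 - 2 * p)\<close>. The condition
  \<open>b * \<kappa> < m\<close> guarantees \<open>\<eta> \<le> 1 / L\<close>. If the gradient vanishes at \<open>x\<close>, both sides are zero.\<close>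

lemma outer_step_contraction:
  fixes \<kappa> \<rho> :: real
  assumes m: "0 < m" and b: "0 < b" "b \<le> n" and c: "\<And>x. F c \<le> F x"
    and \<kappa>: "\<kappa> = L / \<mu>"
    and \<rho>: "\<rho> = (\<kappa> * real m + 4 * \<kappa> * real b * (1 + 1 / real m))
      / (real m * real b - 4 * \<kappa> * real b)" "\<rho> < 1"
    and m_gt: "4 * \<kappa> < real m" "real b * \<kappa> < real m"
    and \<beta>: "\<beta> \<noteq> 0"
  shows "measure_pmf.expectation (outer_step n m b f (steffensen_eta F m b e \<beta> x) x) (\<lambda>x. F x - F c)
    \<le> \<rho> * (F x - F c)"
proof (cases "grad F x = 0")
  case True
  then have "F x \<le> F c"
    using strong_objective[of x c] mu by (simp add: add_increasing2 order_trans[rotated])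
  with c[of x] have "F x = F c" by simp
  then show ?thesis using outer_step_stationary[OF True m b(2)] by simp
next
  case False
  define \<eta> where "\<eta> = steffensen_eta F m b e \<beta> x"
  \<comment> \<open>\<open>\<theta>\<close> is the step size in units of its smallest possible value \<open>b / (m * L)\<close>\<close>
  define \<theta> where "\<theta> = \<eta> * real m * L / real b"
  define r where "r = \<kappa> / real b"
  define p where "p = \<kappa> / real m"
  define Q where "Q = \<eta> * L\<^sup>2 / (real b * \<mu>)"
  define \<Delta> where "\<Delta> = F x - F c"
  define E where "E = measure_pmf.expectation (outer_step n m b f \<eta> x) (\<lambda>x. F x - F c)"
  have rm: "0 < real m" and rb: "0 < real b" using m b by simp_all
  have \<kappa>0: "0 < \<kappa>" using mu L by (simp add: \<kappa>)
  have \<Delta>0: "0 \<le> \<Delta>" using c by (simp add: \<Delta>_def)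
  have p0: "0 < p" using \<kappa>0 rm by (simp add: p_def)
  have lo: "real b / (real m * L) \<le> \<eta>" and hi: "\<eta> \<le> real b / (real m * \<mu>)"
    using steffensen_eta_bounds[OF False \<beta>] by (simp_all add: \<eta>_def)
  have "0 < real b / (real m * L)" using rm rb L by simp
  with lo have \<eta>0: "0 < \<eta>" by linarith
  have "real b / (real m * \<mu>) \<le> 1 / L"
    using m_gt(2) rm mu L by (simp add: \<kappa> field_simps)
  with hi have \<eta>1: "\<eta> \<le> 1 / L" by linarith
  have \<theta>1: "1 \<le> \<theta>" using lo rm rb L by (simp add: \<theta>_def field_simps)
  have \<theta>\<kappa>: "\<theta> \<le> \<kappa>"
  proof -
    have "\<theta> \<le> real b / (real m * \<mu>) * (real m * L / real b)"
      using mult_right_mono[OF hi, of "real m * L / real b"] rm rb L by (simp add: \<theta>_def mult.assoc)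
    also have "\<dots> = \<kappa>" using rm rb mu by (simp add: \<kappa>)
    finally show ?thesis .
  qed
  have \<kappa>p: "\<kappa> * p \<le> r"
  proof -
    have "\<kappa> / real m \<le> 1 / real b" using m_gt(2) rm rb by (simp add: field_simps)
    from mult_left_mono[OF this, of \<kappa>] show ?thesis using \<kappa>0 by (simp add: p_def r_def)
  qed
  have Q_eq: "Q = \<theta> * p"
    using rm rb mu by (simp add: Q_def \<theta>_def p_def \<kappa> power2_eq_square)
  have r_eq: "1 / (\<mu> * \<eta> * real m) = r / \<theta>"
    using rm rb mu L \<eta>0 by (simp add: r_def \<theta>_def \<kappa> field_simps)
  have p4: "0 < 1 - 4 * p" using m_gt(1) rm by (simp add: p_def field_simps)
  have \<rho>_eq: "(1 - 4 * p) * \<rho> = r + 4 * p * (1 + 1 / real m)"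
  proof -
    have "\<kappa> * real m + 4 * \<kappa> * real b * (1 + 1 / real m)
        = real m * real b * (r + 4 * p * (1 + 1 / real m))"
      using rm rb by (simp add: r_def p_def field_simps)
    moreover have "real m * real b - 4 * \<kappa> * real b = real m * real b * (1 - 4 * p)"
      using rm by (simp add: p_def field_simps)
    ultimately have "\<rho> = (r + 4 * p * (1 + 1 / real m)) / (1 - 4 * p)"
      using rm rb by (simp add: \<rho>(1))
    then show ?thesis using p4 by simp
  qed
  have rp: "r + p \<le> r + 4 * p * (1 + 1 / real m)"
  proof -
    have "p \<le> 4 * p + 4 * p / real m" using p0 rm by (simp add: add_increasing2)
    then show ?thesis by (simp add: distrib_left)
  qed
  \<comment> \<open>the hypothesis \<open>\<rho> < 1\<close> keeps the noise parameter \<open>Q * (1 + \<mu> / L)\<close> below 1\<close>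
  have "(1 - 4 * p) * \<rho> \<le> 1 - 4 * p"
    using mult_left_mono[of \<rho> 1 "1 - 4 * p"] \<rho>(2) p4 by simp
  then have "r + 4 * p * (1 + 1 / real m) \<le> 1 - 4 * p" unfolding \<rho>_eq .
  then have rp1: "r + p \<le> 1" using order_trans[OF rp] p0 by fastforce
  have Qk: "Q * \<mu> / L \<le> p"
  proof -
    have "\<theta> / \<kappa> * p \<le> 1 * p" using \<theta>\<kappa> \<kappa>0 p0 by (intro mult_right_mono) auto
    moreover have "Q * \<mu> / L = \<theta> / \<kappa> * p" by (simp add: Q_eq \<kappa>)
    ultimately show ?thesis by simp
  qed
  have "\<theta> * p \<le> \<kappa> * p" using \<theta>\<kappa> p0 by (intro mult_right_mono) auto
  with \<kappa>p Qk rp1 have Q1: "Q * (1 + \<mu> / L) \<le> 1" by (simp add: Q_eq distrib_left)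
  have E0: "0 \<le> E" unfolding E_def using c by (intro integral_nonneg_AE) simp
  have "(1 - 4 * p) * E \<le> (1 - 2 * Q * \<mu> / L) * E"
    using Qk p0 E0 by (intro mult_right_mono) auto
  also have "\<dots> \<le> (1 / (\<mu> * \<eta> * real m) + Q) * \<Delta>"
    using outer_step_bound[OF m b c \<eta>0 \<eta>1 Q_def Q1] by (simp add: E_def \<Delta>_def)
  also have "\<dots> \<le> (r + p) * \<Delta>"
    unfolding r_eq Q_eq using step_size_tradeoff[OF \<theta>1 \<theta>\<kappa> _ \<kappa>p] p0 \<Delta>0
    by (intro mult_right_mono) auto
  also have "\<dots> \<le> (1 - 4 * p) * \<rho> * \<Delta>"
    unfolding \<rho>_eq using rp \<Delta>0 by (rule mult_right_mono)
  finally have "(1 - 4 * p) * E \<le> (1 - 4 * p) * (\<rho> * \<Delta>)" by (simp add: mult.assoc)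
  then have "E \<le> \<rho> * \<Delta>" using p4 by simp
  then show ?thesis by (simp add: E_def \<Delta>_def \<eta>_def)
qed

end

section \<open>Linear convergence\<close>

theorem corollary3p9:
  fixes f :: "nat \<Rightarrow> real ^ 'd \<Rightarrow> real"
    and F :: "real ^ 'd \<Rightarrow> real"
    and x0 xstar :: "real ^ 'd"
    and n m b k :: nat
    and e :: "nat \<Rightarrow> real"
    and \<mu> L \<kappa> \<rho> :: real
  assumes m_pos: "0 < m"
    and b_pos: "0 < b"
    and b_le: "b \<le> n"
    and e_pos: "\<And>j. 0 < e j"
    and mu_pos: "0 < \<mu>"
    and L_pos: "0 < L"
    and F_eq: "F = objective n f"
    and diff: "\<And>i v. i \<in> {1..n} \<Longrightarrow> f i differentiable at v"
    and strong: "\<And>v w. F w \<ge> F v + inner (grad F v) (w - v) + \<mu> / 2 * (norm (v - w))\<^sup>2"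
    and smooth: "\<And>i v w. i \<in> {1..n} \<Longrightarrow> norm (grad (f i) v - grad (f i) w) \<le> L * norm (v - w)"
    and xstar_eq: "xstar = (ARG_MIN F x. True)"
    and kappa_eq: "\<kappa> = L / \<mu>"
    and rho_eq: "\<rho> = (\<kappa> * real m + 4 * \<kappa> * real b * (1 + 1 / real m))
                     / (real m * real b - 4 * \<kappa> * real b)"
    and rho_less: "\<rho> < 1"
    and m_gt: "real m > max (4 * \<kappa>) (real b * \<kappa>)"
  shows "measure_pmf.expectation (ssbb n m b f e x0 k) (\<lambda>x. F x - F xstar)
           \<le> \<rho> ^ k * (F x0 - F xstar)"
proof -
  let ?F = "objective n f"
  interpret smooth_finite_sum f n \<mu> L
    using b_pos b_le mu_pos L_pos diff smooth strong unfolding F_eq by unfold_locales auto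
  have min: "?F xstar \<le> ?F x" for x unfolding xstar_eq F_eq by (rule arg_min_le)
  have \<rho>0: "0 \<le> \<rho>"
  proof -
    have "0 < \<kappa>" using mu_pos L_pos by (simp add: kappa_eq)
    moreover have "0 \<le> (real m - 4 * \<kappa>) * real b" using m_gt by simp
    ultimately show ?thesis unfolding rho_eq by (intro divide_nonneg_nonneg) (auto simp: algebra_simps)
  qed
  let ?\<delta> = "\<lambda>x. ?F x - ?F xstar"
  let ?\<eta> = "\<lambda>k xp x. steffensen_eta ?F m b (e k) (bb_beta ?F k xp x) x"
  have fin: "finite (set_pmf (ssbb_pair n m b f e x0 k))" for k
    by (rule finite_set_pmf_ssbb_pair[OF b_le m_pos])
  have "measure_pmf.expectation (ssbb_pair n m b f e x0 k) (\<lambda>q. ?\<delta> (snd q)) \<le> \<rho> ^ k * ?\<delta> x0"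
  proof (induction k)
    case 0
    show ?case by simp
  next
    case (Suc k)
    have "measure_pmf.expectation (ssbb_pair n m b f e x0 (Suc k)) (\<lambda>q. ?\<delta> (snd q))
      = measure_pmf.expectation (ssbb_pair n m b f e x0 k)
          (\<lambda>(xp, x). measure_pmf.expectation (outer_step n m b f (?\<eta> k xp x) x) ?\<delta>)"
    proof -
      have "finite (set_pmf (map_pmf (Pair x) (outer_step n m b f \<eta> x)))" for \<eta> x
        by (simp add: finite_set_pmf_outer_step[OF b_le m_pos])
      then show ?thesis
        unfolding ssbb_pair.simps Let_def case_prod_unfold
        by (subst expectation_bind_pmf_finite[OF fin]) simp_all
    qed
    also have "\<dots> \<le> measure_pmf.expectation (ssbb_pair n m b f e x0 k) (\<lambda>q. \<rho> * ?\<delta> (snd q))"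
      using outer_step_contraction[OF m_pos b_pos b_le min kappa_eq rho_eq rho_less _ _ bb_beta_nonzero] m_gt
      by (intro expectation_mono_finite[OF fin]) (simp add: case_prod_unfold)
    also have "\<dots> = \<rho> * measure_pmf.expectation (ssbb_pair n m b f e x0 k) (\<lambda>q. ?\<delta> (snd q))"
      by simp
    also have "\<dots> \<le> \<rho> * (\<rho> ^ k * ?\<delta> x0)" using Suc.IH \<rho>0 by (rule mult_left_mono)
    finally show ?case by (simp add: mult.assoc)
  qed
  then show ?thesis by (simp add: ssbb_def F_eq)
qed

end
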